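(* Let $n\ge4$ and let $x_1\ge x_2\ge x_3\ge1$ be integers, all of the same parity, with $x_1+x_2+x_3=n+1$. Then \[ F(x_1,x_2,x_3)\le M(n). \] Consequently, whenever moreover $CB(x_1,x_2,x_3)$ is a simple graph, $N(P_{CB(x_1,x_2,x_3)})\le M(n)$.
   Context: $F(x_1,x_2,x_3)=\sum_{j=0}^{x_3}\binom{x_3}{j}\binom{x_2}{\frac12(x_2-x_3)+j}\binom{x_1}{\frac12(x_1-x_3)+j}$ for $x_1\ge x_2\ge x_3$ of the same parity. $M(n)$ is defined by $M(2k-1)=(k+1)(k-1)\binom{k}{k/2}\binom{k-2}{(k-2)/2}$ for $k$ even, $M(2k-1)=k^2\binom{k-1}{(k-1)/2}^2$ for $k$ odd, and $M(2k)=2M(2k-1)$; for $n\ge5$ it is the number of facets of $P_G$ for $G=C_{k+1}\vee C_{k-1}$ ($n=2k-1$, $k$ even), $C_k\vee C_k$ ($n=2k-1$, $k$ odd), $C_{k+1}\vee C_{k-1}\vee e$ ($n=2k$, $k$ even), $C_k\vee C_k\vee e$ ($n=2k$, $k$ odd), with $C_m$ the $m$-edge cycle, $e$ an edge, $\vee$ a one-vertex identification. $CB(x_1,x_2,x_3)$ is the graph on $n$ vertices and $n+1$ edges consisting of two distinct vertices joined by three internally vertex-disjoint paths of lengths $x_1,x_2,x_3$. For a simple graph $G$ on $[n]$, $P_G=\operatorname{conv}\{\pm(e_i-e_j):\{i,j\}\in E(G)\}$ and $N(P)$ is the number of facets of a polytope $P$. *)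

theory Defs
  imports "HOL-Analysis.Analysis" "HOL-Library.Multiset"
begin

(* Used only for x1 \<ge> x2 \<ge> x3 of equal parity, where the natural-number
   subtractions and halvings are exact. *)
definition F_CB :: "nat \<Rightarrow> nat \<Rightarrow> nat \<Rightarrow> nat" where
  "F_CB x1 x2 x3 =
     (\<Sum>j=0..x3. (x3 choose j) * (x2 choose ((x2 - x3) div 2 + j))
                                * (x1 choose ((x1 - x3) div 2 + j)))"

(* M_odd k is M(2k-1), for k \<ge> 1. *)
definition M_odd :: "nat \<Rightarrow> nat" where
  "M_odd k =
     (if even k
      then (k + 1) * (k - 1) * (k choose (k div 2)) * ((k - 2) choose ((k - 2) div 2))
      else k\<^sup>2 * ((k - 1) choose ((k - 1) div 2))\<^sup>2)"

definition M_max :: "nat \<Rightarrow> nat" where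
  "M_max n = (if odd n then M_odd ((n + 1) div 2) else 2 * M_odd (n div 2))"

(* Undirected multigraphs are given by their vertex set and the multiset of their
   edges, an edge being the set of its end points.  Multiplicities matter because
   CB(x1,x2,x3) has parallel edges when two of the lengths are 1. *)

definition simple_edges :: "'v set multiset \<Rightarrow> bool" where
  "simple_edges E \<longleftrightarrow> (\<forall>e \<in># E. card e = 2 \<and> count E e = 1)"

definition is_path :: "'v \<Rightarrow> 'v \<Rightarrow> nat \<Rightarrow> 'v list \<Rightarrow> bool" where
  "is_path u v l p \<longleftrightarrow> length p = l + 1 \<and> distinct p \<and> hd p = u \<and> last p = v"

definition path_edges :: "'v list \<Rightarrow> 'v set multiset" where
  "path_edges p = mset (map (\<lambda>i. {p ! i, p ! Suc i}) [0..<length p - 1])"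

definition is_CB :: "nat \<Rightarrow> nat \<Rightarrow> nat \<Rightarrow> 'v set \<Rightarrow> 'v set multiset \<Rightarrow> bool" where
  "is_CB x1 x2 x3 V E \<longleftrightarrow>
     (\<exists>u v p q r. u \<noteq> v \<and> is_path u v x1 p \<and> is_path u v x2 q \<and> is_path u v x3 r
        \<and> set p \<inter> set q = {u, v} \<and> set p \<inter> set r = {u, v} \<and> set q \<inter> set r = {u, v}
        \<and> V = set p \<union> set q \<union> set r
        \<and> E = path_edges p + path_edges q + path_edges r)"

definition sym_edge_polytope :: "'n::finite set set \<Rightarrow> (real ^ 'n) set" where
  "sym_edge_polytope E =
     convex hull ({axis i 1 - axis j 1 | i j. {i, j} \<in> E}
                  \<union> {- (axis i 1 - axis j 1) | i j. {i, j} \<in> E})"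

definition num_facets :: "'a::euclidean_space set \<Rightarrow> nat" where
  "num_facets P = card {S. S facet_of P}"

end

theory Submission
  imports Defs
begin

text \<open>
  The purely numerical part is crude: a non-trivial binomial coefficient of row m is at most
  half of the row sum, so F is at most 2^(n-1), whereas the central binomial
  coefficient is at least the average of its row, which makes M(n) at least 2^(n-1).

  For the facets, CB is bipartite since the three lengths have equal parity.  A facet is cut
  out by some f with |f i - f j| \<le> 1 on edges.  Rounding every f i down to the
  nearest integer of the parity prescribed by the colour of i gives g with
  |g i - g j| = 1 on all edges, and edges tight for f stay tight for
  g with the same sign.  By maximality of facets g cuts out the same facet.  Such
  g, normalised to vanish at an end point of the three paths, are counted by F.
\<close>

section \<open>The numerical inequality\<close>

text \<open>By Pascal's rule the entry is a sum of two neighbouring entries of row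
  \<open>m - 1\<close>, which sums to \<open>2 ^ (m - 1)\<close>.\<close>

lemma binomial_le_half_row_sum:
  assumes "m \<ge> 1"
  shows "m choose j \<le> 2 ^ (m - 1)"
proof -
  obtain l where m: "m = Suc l" using assms by (cases m) auto
  show ?thesis
  proof (cases j)
    case 0
    then show ?thesis by simp
  next
    case (Suc i)
    \<comment> \<open>The range goes up to \<open>Suc (i + l)\<close> so that it contains both
      indices even when they exceed \<open>l\<close>; the entries beyond \<open>l\<close>
      vanish.\<close>
    have "(\<Sum>k\<in>{i, Suc i}. l choose k) \<le> (\<Sum>k\<le>Suc (i + l). l choose k)"
      by (rule sum_mono2) auto
    also have "\<dots> = (\<Sum>k\<le>l. l choose k)"
      by (rule sum.mono_neutral_right) auto
    also have "\<dots> = 2 ^ l" by (rule choose_row_sum)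
    finally show ?thesis using m Suc by simp
  qed
qed

lemma row_sum_le_central_binomial: "2 ^ m \<le> (m + 1) * (m choose (m div 2))"
proof -
  have "(2::nat) ^ m = (\<Sum>k\<le>m. m choose k)" by (rule choose_row_sum[symmetric])
  also have "\<dots> \<le> (\<Sum>k\<le>m. m choose (m div 2))"
    by (rule sum_mono) (rule binomial_maximum)
  finally show ?thesis by simp
qed

text \<open>The rows \<open>x1\<close> and \<open>x2\<close> each save a factor 2, while row
  \<open>x3\<close> is summed exactly. For \<open>x1 + x2 + x3 = n + 1\<close> the exponent is
  \<open>n - 1\<close>.\<close>

lemma F_CB_le_power:
  assumes "x1 \<ge> 1" "x2 \<ge> 1"
  shows "F_CB x1 x2 x3 \<le> 2 ^ (x1 + x2 + x3 - 2)"
proof -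
  have "F_CB x1 x2 x3 \<le> (\<Sum>j=0..x3. (x3 choose j) * 2 ^ (x2 - 1) * 2 ^ (x1 - 1))"
    unfolding F_CB_def
    by (intro sum_mono mult_mono binomial_le_half_row_sum assms) auto
  also have "\<dots> = (\<Sum>j\<le>x3. x3 choose j) * 2 ^ (x2 - 1) * 2 ^ (x1 - 1)"
    by (simp add: sum_distrib_right atMost_atLeast0)
  also have "\<dots> = 2 ^ (x3 + (x2 - 1) + (x1 - 1))"
    by (simp add: choose_row_sum power_add)
  also have "x3 + (x2 - 1) + (x1 - 1) = x1 + x2 + x3 - 2" using assms by simp
  finally show ?thesis .
qed

text \<open>\<open>M_odd k\<close> is a product of two factors (row length times central entry), for
  rows \<open>k\<close> and \<open>k - 2\<close> if \<open>k\<close> is even and twice for row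
  \<open>k - 1\<close> if \<open>k\<close> is odd. Either way the row numbers add up to
  \<open>2 * k - 2\<close>.\<close>

lemma power_le_M_odd:
  assumes "k \<ge> 2"
  shows "2 ^ (2 * k - 2) \<le> M_odd k"
proof (cases "even k")
  case True
  have "(2::nat) ^ (2 * k - 2) = 2 ^ k * 2 ^ (k - 2)"
    using assms by (simp flip: power_add)
  also have "\<dots> \<le> ((k + 1) * (k choose (k div 2))) *
      ((k - 2 + 1) * ((k - 2) choose ((k - 2) div 2)))"
    by (intro mult_mono row_sum_le_central_binomial) auto
  also have "k - 2 + 1 = k - 1" using assms by simp
  finally show ?thesis using True by (simp add: M_odd_def algebra_simps)
next
  case False
  have "(2::nat) ^ (2 * k - 2) = (2 ^ (k - 1))\<^sup>2"
    using assms by (simp add: right_diff_distrib' mult.commute flip: power_mult)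
  also have "\<dots> \<le> ((k - 1 + 1) * ((k - 1) choose ((k - 1) div 2)))\<^sup>2"
    by (intro power_mono row_sum_le_central_binomial) auto
  also have "k - 1 + 1 = k" using assms by simp
  finally show ?thesis using False by (simp add: M_odd_def power_mult_distrib)
qed

lemma power_le_M_max:
  assumes "n \<ge> 3"
  shows "2 ^ (n - 1) \<le> M_max n"
proof (cases "odd n")
  case True
  then obtain m where "n = 2 * m + 1" by (elim oddE)
  then show ?thesis using assms power_le_M_odd[of "m + 1"] by (simp add: M_max_def)
next
  case False
  then obtain m where n: "n = 2 * m" by auto
  then have "n - 1 = Suc (2 * m - 2)" using assms by simp
  then show ?thesis using n assms power_le_M_odd[of m] by (simp add: M_max_def)
qed

section \<open>Facets of symmetric edge polytopes of bipartite graphs\<close>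

text \<open>Edges are unordered, so each one already contributes both orientations and the
  generators are closed under negation.\<close>

lemma sym_edge_polytope_altdef:
  "sym_edge_polytope E = convex hull {axis i 1 - axis j 1 | i j. {i, j} \<in> E}"
proof -
  have "{- (axis i 1 - axis j 1) | i j. {i, j} \<in> E}
      \<subseteq> {axis i 1 - axis j (1::real) | i j. {i, j} \<in> E}"
    by (auto simp: insert_commute) (metis insert_commute)
  then show ?thesis by (simp add: sym_edge_polytope_def Un_absorb2)
qed

text \<open>Facets are maximal proper faces: a strict inclusion of faces lowers the dimension, so a
  face strictly between would give \<open>S\<close> codimension at least 2.\<close>

lemma facet_of_eq_proper_face:
  fixes P :: "'a::euclidean_space set"
  assumes "S facet_of P" "T face_of P" "T \<noteq> P" "S \<subseteq> T" "convex P"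
  shows "S = T"
proof (rule ccontr)
  assume "S \<noteq> T"
  have "S face_of T"
    using assms face_of_subset facet_of_imp_face_of face_of_imp_subset by metis
  moreover have "convex T" using assms face_of_imp_convex by blast
  ultimately have "aff_dim S < aff_dim T" using \<open>S \<noteq> T\<close> by (simp add: face_of_aff_dim_lt)
  moreover have "aff_dim T < aff_dim P" using assms by (simp add: face_of_aff_dim_lt)
  ultimately show False using assms(1) by (simp add: facet_of_def)
qed

text \<open>\<open>r s a\<close> is the largest integer of the parity of \<open>a\<close> that is at
  most \<open>s\<close>. The difference of the two roundings is odd and lies strictly between -3 and
  3; if \<open>s - t = 1\<close>, it also exceeds -1.\<close>

lemma parity_rounding:
  fixes s t :: real and a b :: int
  defines "r \<equiv> \<lambda>(s::real) (a::int). a + 2 * \<lfloor>(s - of_int a) / 2\<rfloor>"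
  assumes "odd (a - b)" "\<bar>s - t\<bar> \<le> 1"
  shows "\<bar>r s a - r t b\<bar> = 1" and "s - t = 1 \<Longrightarrow> r s a - r t b = 1"
proof -
  have r: "of_int (r s a) \<le> s \<and> s < of_int (r s a) + 2" for s a
    unfolding r_def using floor_correct[of "(s - of_int a) / 2"] by (simp add: field_simps)
  have "odd (r s a - r t b)" using assms(2) by (simp add: r_def)
  moreover have "r s a - r t b < 3" "r s a - r t b > -3"
    using r[of s a] r[of t b] assms(3) by linarith+
  ultimately show *: "\<bar>r s a - r t b\<bar> = 1" by presburger
  assume "s - t = 1"
  then have "r s a - r t b > -1" using r[of s a] r[of t b] by linarith
  with * show "r s a - r t b = 1" by linarith
qed

text \<open>The parity of \<open>c\<close> is a proper 2-colouring. Only one direction is claimed: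
  every facet comes from some \<open>g\<close>, which is what an upper bound on the number of facets
  requires.\<close>

lemma facet_of_bipartite_sym_edge_polytope:
  fixes E :: "'n::finite set set" and c :: "'n \<Rightarrow> int"
  assumes col: "\<And>i j. {i, j} \<in> E \<Longrightarrow> odd (c i - c j)"
    and facet: "S facet_of sym_edge_polytope E"
  shows "\<exists>g :: 'n \<Rightarrow> int. (\<forall>i j. {i, j} \<in> E \<longrightarrow> \<bar>g i - g j\<bar> = 1) \<and>
    S = convex hull {axis i 1 - axis j 1 | i j. {i, j} \<in> E \<and> g i - g j = 1}"
proof -
  define V :: "(real ^ 'n) set" where "V = {axis i 1 - axis j 1 | i j. {i, j} \<in> E}"
  define P where "P = sym_edge_polytope E"
  have P: "P = convex hull V" by (simp add: P_def V_def sym_edge_polytope_altdef)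
  have "V \<subseteq> (\<lambda>(i, j). axis i 1 - axis j 1) ` UNIV" by (auto simp: V_def)
  then have "finite V" by (rule finite_subset) simp
  have V_uminus: "- v \<in> V" if "v \<in> V" for v
    using that by (auto simp: V_def) (metis insert_commute minus_diff_eq)
  have "convex P" by (simp add: P)
  have S: "S facet_of P" using facet by (simp add: P_def)
  have "polyhedron P"
    using \<open>finite V\<close> by (simp add: P polytope_convex_hull polytope_imp_polyhedron)
  then obtain a b where ab: "P \<subseteq> {x. a \<bullet> x \<le> b}" "S = P \<inter> {x. a \<bullet> x = b}"
    using facet_of_polyhedron[OF _ S] by metis
  have "S \<noteq> P" using S by (auto simp: facet_of_def)
  have "V \<noteq> {}" using S by (auto simp: P facet_of_def)
  have V_le: "a \<bullet> v \<le> b" if "v \<in> V" for v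
    using that ab(1) hull_subset[of V convex] by (auto simp: P)
  have V_ge: "- (a \<bullet> v) \<le> b" if "v \<in> V" for v
    using V_le[OF V_uminus[OF that]] by simp
  \<comment> \<open>For \<open>b \<le> 0\<close> the symmetry of \<open>V\<close> forces
    \<open>a\<close> to take the value \<open>b\<close> on all generators, so the supporting
    hyperplane would contain \<open>P\<close>.\<close>
  have "b > 0"
  proof (rule ccontr)
    assume "\<not> b > 0"
    then have "V \<subseteq> {x. a \<bullet> x = b}" using V_le V_ge by force
    then have "P \<subseteq> {x. a \<bullet> x = b}" by (simp add: P hull_minimal convex_hyperplane)
    with ab(2) \<open>S \<noteq> P\<close> show False by auto
  qed
  \<comment> \<open>Dividing by \<open>b\<close> puts the facet at level 1, so tight edges have
    difference exactly 1; each coordinate is then rounded down within its colour class.\<close>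
  define g where "g i = c i + 2 * \<lfloor>(a $ i / b - of_int (c i)) / 2\<rfloor>" for i
  have a_axis: "a \<bullet> (axis i 1 - axis j 1) = a $ i - a $ j" for i j
    by (simp add: inner_diff_right inner_axis)
  have edge_le: "\<bar>a $ i / b - a $ j / b\<bar> \<le> 1" if "{i, j} \<in> E" for i j
  proof -
    have "axis i 1 - axis j 1 \<in> V" using that by (auto simp: V_def)
    from V_le[OF this] V_ge[OF this] have "\<bar>a $ i - a $ j\<bar> \<le> b" by (simp add: a_axis)
    then show ?thesis using \<open>b > 0\<close> by (simp flip: diff_divide_distrib)
  qed
  have g: "\<bar>g i - g j\<bar> = 1" if "{i, j} \<in> E" for i j
    unfolding g_def by (rule parity_rounding(1)[OF col[OF that] edge_le[OF that]])
  have g_tight: "g i - g j = 1" if "{i, j} \<in> E" "a $ i - a $ j = b" for i j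
    unfolding g_def
    by (rule parity_rounding(2)[OF col[OF that(1)] edge_le[OF that(1)]])
      (use that(2) \<open>b > 0\<close> in \<open>simp flip: diff_divide_distrib\<close>)
  define y :: "real ^ 'n" where "y = (\<chi> i. of_int (g i))"
  have y_axis: "y \<bullet> (axis i 1 - axis j 1) = of_int (g i - g j)" for i j
    by (simp add: inner_diff_right inner_axis y_def)
  define W where "W = {axis i 1 - axis j (1::real) | i j. {i, j} \<in> E \<and> g i - g j = 1}"
  have W: "W = V \<inter> {x. y \<bullet> x = 1}"
    unfolding W_def V_def using y_axis by fastforce
  have y_V: "\<bar>y \<bullet> v\<bar> = 1" if "v \<in> V" for v
    using that by (auto simp: V_def y_axis g simp del: of_int_diff simp flip: of_int_abs)
  have y_le: "P \<subseteq> {x. y \<bullet> x \<le> 1}"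
    unfolding P using y_V by (intro hull_minimal convex_halfspace_le) force
  define T where "T = P \<inter> {x. y \<bullet> x = 1}"
  have "T face_of P"
    unfolding T_def using y_le \<open>convex P\<close> by (intro face_of_Int_supporting_hyperplane_le) auto
  moreover have "T \<noteq> P"
  proof -
    obtain v where v: "v \<in> V" using \<open>V \<noteq> {}\<close> by auto
    then have "v \<in> P" "- v \<in> P" using V_uminus hull_subset[of V convex] by (auto simp: P)
    moreover have "y \<bullet> v \<noteq> 1 \<or> y \<bullet> (- v) \<noteq> 1" by simp
    ultimately show ?thesis unfolding T_def by blast
  qed
  \<comment> \<open>A face of the hull of finitely many points is the hull of some of them, so it
    suffices to compare generators.\<close>
  moreover obtain S' where S': "S' \<subseteq> V" "S = convex hull S'"
    using face_of_convex_hull_subset[of V S] S \<open>finite V\<close> finite_imp_compact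
      facet_of_imp_face_of unfolding P by metis
  have "S' \<subseteq> W"
  proof
    fix v assume "v \<in> S'"
    then have "v \<in> V" "a \<bullet> v = b" using S' ab(2) hull_subset[of S' convex] by auto
    moreover from this obtain i j where "{i, j} \<in> E" "v = axis i 1 - axis j 1"
      by (auto simp: V_def)
    ultimately show "v \<in> W" using g_tight[of i j] a_axis[of i j] unfolding W_def by auto
  qed
  have "convex hull W \<subseteq> T"
    unfolding T_def P W by (intro Int_greatest hull_mono hull_minimal convex_hyperplane) auto
  moreover have "S \<subseteq> convex hull W" unfolding S'(2) by (rule hull_mono) fact
  \<comment> \<open>The hull of \<open>W\<close> lies between \<open>S\<close> and the proper face
    \<open>T\<close>, which coincide by maximality of the facet.\<close>
  ultimately have "S = convex hull W"
    using facet_of_eq_proper_face[OF S _ _ _ \<open>convex P\<close>, of T] by auto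
  with g show ?thesis unfolding W_def by blast
qed

section \<open>Counting height functions on three paths\<close>

text \<open>Encodes a walk with steps +1 and -1 along \<open>p\<close> by the positions of its
  ascents. Together with the initial height this set determines the walk, and its cardinality
  determines the final height.\<close>

definition up_steps :: "('v \<Rightarrow> int) \<Rightarrow> 'v list \<Rightarrow> nat set" where
  "up_steps g p = {i. Suc i < length p \<and> g (p ! Suc i) = g (p ! i) + 1}"

lemma is_path_nth:
  assumes "is_path u v l p"
  shows "length p = Suc l" "p ! 0 = u" "p ! l = v"
proof -
  show len: "length p = Suc l" using assms by (simp add: is_path_def)
  then have "p \<noteq> []" by auto
  then show "p ! 0 = u" "p ! l = v"
    using assms len by (auto simp: is_path_def hd_conv_nth last_conv_nth)
qed

lemma in_path_edges_iff:
  "e \<in># path_edges p \<longleftrightarrow> (\<exists>i. Suc i < length p \<and> e = {p ! i, p ! Suc i})"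
proof -
  have "i < length p - 1 \<longleftrightarrow> Suc i < length p" for i by linarith
  then show ?thesis by (auto simp: path_edges_def)
qed

lemma height_eq_sum_up_steps:
  assumes "\<And>i. Suc i < length p \<Longrightarrow> \<bar>g (p ! i) - g (p ! Suc i)\<bar> = 1" and "i < length p"
  shows "g (p ! i) = g (p ! 0) + (\<Sum>m<i. if m \<in> up_steps g p then 1 else - 1)"
  using assms(2)
proof (induction i)
  case (Suc i)
  then have "g (p ! Suc i) = g (p ! i) + (if i \<in> up_steps g p then 1 else - 1)"
    using assms(1)[of i] by (auto simp: up_steps_def)
  with Suc show ?case by simp
qed simp

lemma height_last_eq_card_up_steps:
  assumes "is_path u v l p"
    and "\<And>i. Suc i < length p \<Longrightarrow> \<bar>g (p ! i) - g (p ! Suc i)\<bar> = 1"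
  shows "g v = g u + 2 * int (card (up_steps g p)) - int l"
proof -
  let ?U = "up_steps g p"
  note l = is_path_nth[OF assms(1)]
  have sub: "?U \<subseteq> {..<l}" using l by (auto simp: up_steps_def)
  have "g v = g u + (\<Sum>m<l. if m \<in> ?U then 1 else - 1)"
    using height_eq_sum_up_steps[OF assms(2), of l] l by simp
  also have "(\<Sum>m<l. if m \<in> ?U then 1 else - 1 :: int) = (\<Sum>m<l. 2 * (if m \<in> ?U then 1 else 0) - 1)"
    by (rule sum.cong) auto
  also have "\<dots> = 2 * (\<Sum>m<l. if m \<in> ?U then 1 else 0) - int l"
    by (simp add: sum_subtractf sum_distrib_left)
  also have "(\<Sum>m<l. if m \<in> ?U then 1 else 0 :: int) = int (card ?U)"
    using sub by (simp add: sum.If_cases Int_absorb1)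
  finally show ?thesis by simp
qed

lemma up_steps_inj:
  assumes "\<And>i. Suc i < length p \<Longrightarrow> \<bar>g (p ! i) - g (p ! Suc i)\<bar> = 1"
    and "\<And>i. Suc i < length p \<Longrightarrow> \<bar>h (p ! i) - h (p ! Suc i)\<bar> = 1"
    and "up_steps g p = up_steps h p" "g (p ! 0) = h (p ! 0)" "w \<in> set p"
  shows "g w = h w"
proof -
  obtain i where i: "i < length p" "w = p ! i" using assms(5) by (metis in_set_conv_nth)
  show ?thesis
    unfolding i(2) using height_eq_sum_up_steps[of p g i] height_eq_sum_up_steps[of p h i] assms i
    by simp
qed

text \<open>Since the paths cover all vertices, \<open>g\<close> is determined by its three sets of
  up-steps. The three expressions for \<open>g v\<close> must agree, so the number \<open>j\<close>
  of up-steps on the path of length \<open>x3\<close> fixes the numbers on the other two; this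
  \<open>j\<close> is the summation index of \<open>F_CB\<close>.\<close>

lemma card_path_heights_le_F_CB:
  fixes u v :: 'v
  assumes paths: "is_path u v x1 p" "is_path u v x2 q" "is_path u v x3 r"
    and cover: "set p \<union> set q \<union> set r = UNIV"
    and le: "x1 \<ge> x2" "x2 \<ge> x3"
    and parity: "even x1 \<longleftrightarrow> even x2" "even x2 \<longleftrightarrow> even x3"
  defines "G \<equiv> {g :: 'v \<Rightarrow> int. g u = 0 \<and>
    (\<forall>l \<in> {p, q, r}. \<forall>i. Suc i < length l \<longrightarrow> \<bar>g (l ! i) - g (l ! Suc i)\<bar> = 1)}"
  shows "finite G \<and> card G \<le> F_CB x1 x2 x3"
proof -
  define sub where "sub x m = {A. A \<subseteq> {..<x} \<and> card A = m}" for x m :: nat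
  define X where "X = (\<Union>j\<in>{0..x3}. sub x3 j \<times> sub x2 ((x2 - x3) div 2 + j)
    \<times> sub x1 ((x1 - x3) div 2 + j))"
  define ups where "ups g = (up_steps g r, up_steps g q, up_steps g p)" for g
  have fin_sub: "finite (sub x m)" for x m by (simp add: sub_def)
  have card_sub: "card (sub x m) = x choose m" for x m by (simp add: sub_def n_subsets)
  have "finite X" by (simp add: X_def fin_sub)
  have "card X \<le> F_CB x1 x2 x3"
    unfolding X_def F_CB_def
    by (rule order_trans[OF card_UN_le]) (simp_all add: card_cartesian_product card_sub mult_ac)
  have head: "p ! 0 = u" "q ! 0 = u" "r ! 0 = u"
    using paths is_path_nth(2) by metis+
  have "inj_on ups G"
  proof (rule inj_onI, rule ext)
    fix g h w
    assume gh: "g \<in> G" "h \<in> G" "ups g = ups h"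
    have "w \<in> set p \<or> w \<in> set q \<or> w \<in> set r" using cover by blast
    then obtain l where l: "l \<in> {p, q, r}" "w \<in> set l" by blast
    show "g w = h w"
      by (rule up_steps_inj[of l]) (use gh l head in \<open>auto simp: G_def ups_def\<close>)
  qed
  moreover have "ups ` G \<subseteq> X"
  proof
    fix z assume "z \<in> ups ` G"
    then obtain g where g: "g \<in> G" and z: "z = ups g" by blast
    have ends: "g v = g u + 2 * int (card (up_steps g p)) - int x1"
      "g v = g u + 2 * int (card (up_steps g q)) - int x2"
      "g v = g u + 2 * int (card (up_steps g r)) - int x3"
      by (rule height_last_eq_card_up_steps; use paths g in \<open>auto simp: G_def\<close>)+
    have subs: "up_steps g p \<subseteq> {..<x1}" "up_steps g q \<subseteq> {..<x2}" "up_steps g r \<subseteq> {..<x3}"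
      using paths by (auto simp: up_steps_def is_path_def)
    let ?j = "card (up_steps g r)"
    have "?j \<le> x3" using card_mono[OF _ subs(3)] by simp
    moreover have "card (up_steps g q) = (x2 - x3) div 2 + ?j"
      "card (up_steps g p) = (x1 - x3) div 2 + ?j"
      using ends le parity by presburger+
    ultimately show "z \<in> X" using subs by (auto simp: X_def sub_def z ups_def)
  qed
  ultimately have "finite G" "card G \<le> card X"
    using \<open>finite X\<close> by (auto intro: inj_on_finite card_inj_on_le)
  with \<open>card X \<le> F_CB x1 x2 x3\<close> show ?thesis by simp
qed

section \<open>Bipartiteness of three joined paths and the resulting facet bound\<close>

text \<open>Each vertex is coloured by its position on a path containing it. Paths meet only in
  \<open>u\<close>, at position 0 on each, and in \<open>v\<close>, at positions \<open>x1\<close>,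
  \<open>x2\<close>, \<open>x3\<close> of equal parity, so the parity does not depend on the
  path.\<close>

lemma path_colouring_CB:
  assumes paths: "is_path u v x1 p" "is_path u v x2 q" "is_path u v x3 r"
    and meet: "set p \<inter> set q = {u, v}" "set p \<inter> set r = {u, v}" "set q \<inter> set r = {u, v}"
    and parity: "even x1 \<longleftrightarrow> even x2" "even x2 \<longleftrightarrow> even x3"
  shows "\<exists>c :: 'v \<Rightarrow> int. \<forall>l \<in> {p, q, r}. \<forall>i < length l. even (c (l ! i)) \<longleftrightarrow> even i"
proof -
  define idx where "idx l w = (THE i. i < length l \<and> l ! i = w)" for l and w :: 'v
  have idx: "idx l (l ! i) = i" if "distinct l" "i < length l" for l :: "'v list" and i
    unfolding idx_def using that by (intro the_equality) (auto simp: nth_eq_iff_index_eq)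
  define c where "c w = int (if w \<in> set p then idx p w else if w \<in> set q then idx q w else idx r w)"
    for w
  have ends: "distinct l \<and> length l = Suc x \<and> l ! 0 = u \<and> l ! x = v" if "is_path u v x l" for l x
    using that is_path_nth[OF that] by (simp add: is_path_def)
  have idx_ends: "idx l u = 0 \<and> idx l v = x" if "is_path u v x l" for l x
    using ends[OF that] idx[of l 0] idx[of l x] by auto
  have cp: "c w = int (idx p w)" if "w \<in> set p" for w using that by (simp add: c_def)
  have cq: "even (c w) \<longleftrightarrow> even (idx q w)" if "w \<in> set q" for w
  proof -
    have "w \<in> set p \<Longrightarrow> w = u \<or> w = v" using that meet by blast
    then show ?thesis
      using that idx_ends[OF paths(1)] idx_ends[OF paths(2)] parity by (auto simp: c_def)
  qed
  have cr: "even (c w) \<longleftrightarrow> even (idx r w)" if "w \<in> set r" for w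
  proof -
    have "w \<in> set p \<or> w \<in> set q \<Longrightarrow> w = u \<or> w = v" using that meet by blast
    then show ?thesis
      using that idx_ends[OF paths(1)] idx_ends[OF paths(2)] idx_ends[OF paths(3)] parity
      by (auto simp: c_def)
  qed
  have "even (c (l ! i)) \<longleftrightarrow> even i" if "l \<in> {p, q, r}" "i < length l" for l i
  proof -
    have "distinct l" using that paths by (auto simp: is_path_def)
    then have "idx l (l ! i) = i" using that by (simp add: idx)
    moreover have "l ! i \<in> set l" using that by simp
    ultimately show ?thesis using that(1) cp cq cr by auto
  qed
  then show ?thesis by blast
qed

lemma num_facets_CB_le_F_CB:
  fixes E :: "'n::finite set multiset"
  assumes CB: "is_CB x1 x2 x3 (UNIV :: 'n set) E"
    and le: "x1 \<ge> x2" "x2 \<ge> x3"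
    and parity: "even x1 \<longleftrightarrow> even x2" "even x2 \<longleftrightarrow> even x3"
  shows "num_facets (sym_edge_polytope (set_mset E)) \<le> F_CB x1 x2 x3"
proof -
  obtain u v p q r where paths: "is_path u v x1 p" "is_path u v x2 q" "is_path u v x3 r"
    and meet: "set p \<inter> set q = {u, v}" "set p \<inter> set r = {u, v}" "set q \<inter> set r = {u, v}"
    and cover: "set p \<union> set q \<union> set r = UNIV"
    and E: "E = path_edges p + path_edges q + path_edges r"
    using CB unfolding is_CB_def by metis
  obtain c :: "'n \<Rightarrow> int" where c: "\<forall>l \<in> {p, q, r}. \<forall>i < length l. even (c (l ! i)) \<longleftrightarrow> even i"
    using path_colouring_CB[OF paths meet parity] by blast
  have col: "odd (c i - c j)" if ij: "{i, j} \<in># E" for i j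
  proof -
    obtain l where l: "l \<in> {p, q, r}" "{i, j} \<in># path_edges l" using ij by (auto simp: E)
    then obtain m where m: "Suc m < length l" "{i, j} = {l ! m, l ! Suc m}"
      by (metis in_path_edges_iff)
    have "even (c (l ! m)) \<longleftrightarrow> even m" "even (c (l ! Suc m)) \<longleftrightarrow> even (Suc m)"
      using c l m by (meson Suc_lessD)+
    then show ?thesis using m(2) by (auto simp: doubleton_eq_iff)
  qed
  define G where "G = {g :: 'n \<Rightarrow> int. g u = 0 \<and>
    (\<forall>l \<in> {p, q, r}. \<forall>i. Suc i < length l \<longrightarrow> \<bar>g (l ! i) - g (l ! Suc i)\<bar> = 1)}"
  have G: "finite G" "card G \<le> F_CB x1 x2 x3"
    using card_path_heights_le_F_CB[OF paths cover le parity] by (auto simp: G_def)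
  define face where
    "face g = convex hull {axis i 1 - axis j (1::real) | i j. {i, j} \<in># E \<and> g i - g j = 1}"
    for g :: "'n \<Rightarrow> int"
  have "{S. S facet_of sym_edge_polytope (set_mset E)} \<subseteq> face ` G"
  proof
    fix S assume "S \<in> {S. S facet_of sym_edge_polytope (set_mset E)}"
    then obtain g where g: "\<forall>i j. {i, j} \<in># E \<longrightarrow> \<bar>g i - g j\<bar> = 1" "S = face g"
      using facet_of_bipartite_sym_edge_polytope[of "set_mset E" c S] col
      unfolding face_def by blast
    \<comment> \<open>Subtracting a constant preserves all differences, hence the face, and achieves
      the normalisation \<open>h u = 0\<close> that makes the functions finite in number.\<close>
    define h where "h i = g i - g u" for i
    have "{l ! i, l ! Suc i} \<in># E" if "l \<in> {p, q, r}" "Suc i < length l" for l i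
    proof -
      have "{l ! i, l ! Suc i} \<in># path_edges l" using that(2) in_path_edges_iff by blast
      then show ?thesis using that(1) by (auto simp: E)
    qed
    then have "h \<in> G" using g(1) by (auto simp: G_def h_def)
    moreover have "face h = face g" by (simp add: face_def h_def)
    ultimately show "S \<in> face ` G" using g(2) by blast
  qed
  then have "num_facets (sym_edge_polytope (set_mset E)) \<le> card G"
    unfolding num_facets_def using surj_card_le[OF G(1)] by blast
  with G(2) show ?thesis by linarith
qed

theorem theorem4p10:
  fixes n x1 x2 x3 :: nat and E :: "'n::finite set multiset"
  assumes "n \<ge> 4"
    and "x1 \<ge> x2" and "x2 \<ge> x3" and "x3 \<ge> 1"
    and "even x1 \<longleftrightarrow> even x2" and "even x2 \<longleftrightarrow> even x3"
    and "x1 + x2 + x3 = n + 1"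
  shows "F_CB x1 x2 x3 \<le> M_max n \<and>
    (CARD('n) = n \<and> is_CB x1 x2 x3 (UNIV :: 'n set) E \<and> simple_edges E
      \<longrightarrow> num_facets (sym_edge_polytope (set_mset E)) \<le> M_max n)"
proof -
  have "F_CB x1 x2 x3 \<le> 2 ^ (n - 1)"
    using F_CB_le_power[of x1 x2 x3] assms by simp
  also have "\<dots> \<le> M_max n" using power_le_M_max assms by simp
  finally have "F_CB x1 x2 x3 \<le> M_max n" .
  then show ?thesis using num_facets_CB_le_F_CB[of x1 x2 x3 E] assms by auto
qed

end
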